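(* Let $R_1>0$ and let $g$ be real analytic and $1$-periodic, with zero mean, extending holomorphically to $S_{R_1}$ so that $\|g\|_{R_1}<c/3$, where $c=c(\tau,R_1)>0$ is the constant with property (P) described in the context. Let $\beta$ be Mather's $\beta$-function of $T_g$. Then there exists $M>2\zeta(1+\tau)$ such that, for every $\omega_0\in\mathbb{R}$, the function $\beta|_{A_M^{\mathbb{R}}}$ is determined by the restriction of $\beta$ to any subset of $[\omega_0,\omega_0+1]$ of Lebesgue measure $\ge\big(\frac{3\|g\|_{R_1}}{c}\big)^{1/8}$. One can take $M=2\zeta(1+\tau)\big(\frac{c}{2\|g\|_{R_1}}\big)^{1/8}$.
   Context: **The map and $\beta$.** For a $1$-periodic real analytic $g:\mathbb{R}\to\mathbb{R}$ of zero mean, let $T_g(x,y)=(x',y')$ with $x'=x+y+g(x)$, $y'=y+g(x)$. Let $G$ be the primitive of $g$ with zero mean (it is real analytic and $1$-periodic), and $h(x,x')=\frac12(x-x')^2+G(x)$. A sequence $(x_j)_{j\in\mathbb{Z}}$ of reals is a minimal configuration if, for all $N_1<N_2$, the segment $(x_{N_1},\dots,x_{N_2})$ minimizes $\sum_{N_1\le j<N_2}h(x_j,x_{j+1})$ among all real segments of the same length with the same end-points. It has rotation number $\omega$ if $x_j/j\to\omega$ as $j\to\pm\infty$. Mather's $\beta$-function $\beta:\mathbb{R}\to\mathbb{R}$ is $$\beta(\omega)=\lim_{N_1\to-\infty,\,N_2\to+\infty}\frac{1}{N_2-N_1}\sum_{N_1\le j<N_2}h(x_j,x_{j+1}),$$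 where $(x_j)$ is any minimal configuration of rotation number $\omega$ (by Aubry–Mather theory such configurations exist for every $\omega\in\mathbb{R}$, and the limit exists and does not depend on the choice). It is known that $\beta$ is continuous on $\mathbb{R}$ and differentiable at every irrational. **Sets.** $\tau>0$ is fixed once and for all; $\zeta$ is Riemann's zeta function; $\mathbb{N}^*$ is the set of positive integers. For $M>2\zeta(1+\tau)$, $$A_M^{\mathbb{R}}=\{\omega\in\mathbb{R}:\ |\omega-\tfrac nm|\ge\tfrac{1}{Mm^{2+\tau}}\ \ \forall (n,m)\in\mathbb{Z}\times\mathbb{N}^*\},$$ $$A_M^{\mathbb{C}}=\{\omega\in\mathbb{C}:\ \exists\,\omega_*\in A_M^{\mathbb{R}}\text{ with }|\operatorname{Im}\omega|\ge|\omega_*-\operatorname{Re}\omega|\}.$$ With $E(\omega)=e^{2\pi i\omega}$, set $K_M=E(A_M^{\mathbb{C}})\cup\{0,\infty\}\subset\widehat{\mathbb{C}}$ (Riemann sphere). For $R>0$, $S_R=\{z\in\mathbb{C}/\mathbb{Z}:|\operatorname{Im}z|<R\}$ and $\|\varphi\|_R=\sup_{S_R}|\varphi|$ for $\varphi:S_R\to\mathbb{C}$. **$\mathscr{C}^1$-holomorphic functions.** For $C\subset\mathbb{C}$ closed and perfect, $\mathscr{C}^1_{\mathrm{hol}}(C)$ is the space of bounded continuous $\psi:C\to\mathbb{C}$ for which there is a bounded continuous $\psi':C\to\mathbb{C}$ (necessarily unique, called the derivative) such that $\Omega\psi:C\times C\to\mathbb{C}$, $\Omega\psi(q,q)=\psi'(q)$,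 $\Omega\psi(q,q')=\frac{\psi(q')-\psi(q)}{q'-q}$ for $q\ne q'$, is continuous and bounded. For $K\subset\widehat{\mathbb{C}}$ compact and perfect, $\varphi:K\to\mathbb{C}$ belongs to $\mathscr{C}^1_{\mathrm{hol}}(K)$ if $\varphi|_{K\cap\mathbb{C}}\in\mathscr{C}^1_{\mathrm{hol}}(K\cap\mathbb{C})$ and $\check\varphi:\xi\mapsto\varphi(1/\xi)$ belongs to $\mathscr{C}^1_{\mathrm{hol}}(\check K)$, where $\check K=\{\xi\in\mathbb{C}:1/\xi\in K\}$ (with $1/0=\infty$). **Property (P) of $c=c(\tau,R_1)$.** For any real analytic $1$-periodic $g$ with zero mean extending holomorphically to $S_{R_1}$ with $\|g\|_{R_1}<c$, and any $M$ with $1<\frac{M}{2\zeta(1+\tau)}<\big(\frac{c}{\|g\|_{R_1}}\big)^{1/8}$, there is a function $\Phi_\beta^{\mathbb{C}}\in\mathscr{C}^1_{\mathrm{hol}}(A_M^{\mathbb{C}})$ such that $\beta_{\mathbb{C}}(\omega):=\frac{\omega^2}{2}+\Phi_\beta^{\mathbb{C}}(\omega)$ satisfies $\beta_{\mathbb{C}}=\beta$ and $\beta_{\mathbb{C}}'=\beta'$ on $A_M^{\mathbb{R}}$, $\Phi_\beta^{\mathbb{C}}$ is even and $1$-periodic, $\overline{\Phi_\beta^{\mathbb{C}}(\omega)}=\Phi_\beta^{\mathbb{C}}(\overline\omega)$, and $\Phi_\beta^{\mathbb{C}}=\tilde\Phi\circ E$ for some $\tilde\Phi\in\mathscr{C}^1_{\mathrm{hol}}(K_M)$.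 A constant $c(\tau,R_1)>0$ with this property exists (this is the main theorem of the same work). *)

theory Defs
  imports "HOL-Complex_Analysis.Complex_Analysis"
begin

definition real_analytic :: "(real \<Rightarrow> real) \<Rightarrow> bool" where
  "real_analytic g \<longleftrightarrow>
     (\<forall>x. \<exists>r>0. \<exists>a. \<forall>y. \<bar>y - x\<bar> < r \<longrightarrow> (\<lambda>n. a n * (y - x) ^ n) sums g y)"

definition strip :: "real \<Rightarrow> complex set" where
  "strip R = {z. \<bar>Im z\<bar> < R}"

text \<open>A function on the quotient of the strip by the integers is encoded as a \<open>1\<close>-periodic
  function on the strip.\<close>

definition strip_extension :: "real \<Rightarrow> (real \<Rightarrow> real) \<Rightarrow> (complex \<Rightarrow> complex) \<Rightarrow> bool" where
  "strip_extension R g F \<longleftrightarrow>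
     F holomorphic_on strip R \<and> (\<forall>z\<in>strip R. F (z + 1) = F z) \<and>
     (\<forall>x. F (complex_of_real x) = complex_of_real (g x))"

text \<open>The extension is unique on the strip, see \<open>strip_extension_unique\<close> below. The supremum is
  meaningful only if the extension is bounded, which \<open>admissible\<close> requires.\<close>

definition strip_norm :: "real \<Rightarrow> (real \<Rightarrow> real) \<Rightarrow> real" where
  "strip_norm R g = (SUP z\<in>strip R. norm ((SOME F. strip_extension R g F) z))"

definition admissible :: "real \<Rightarrow> (real \<Rightarrow> real) \<Rightarrow> bool" where
  "admissible R g \<longleftrightarrow>
     real_analytic g \<and> (\<forall>x. g (x + 1) = g x) \<and> integral {0..1} g = 0 \<and>
     (\<exists>F. strip_extension R g F \<and> bounded (F ` strip R))"

lemma strip_extension_unique: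
  assumes "R > 0" "strip_extension R g F" "strip_extension R g F'" "z \<in> strip R"
  shows "F z = F' z"
proof -
  have op: "open (strip R)"
    unfolding strip_def by (intro open_Collect_less continuous_intros)
  have "strip R = {z. Im z < R} \<inter> {z. - R < Im z}"
    by (auto simp: strip_def)
  hence "convex (strip R)"
    by (simp add: convex_Int convex_halfspace_Im_lt convex_halfspace_Im_gt)
  hence conn: "connected (strip R)"
    by (rule convex_connected)
  have "F holomorphic_on strip R" "F' holomorphic_on strip R"
    using assms(2,3) unfolding strip_extension_def by blast+
  hence holo: "(\<lambda>w. F w - F' w) holomorphic_on strip R"
    by (rule holomorphic_on_diff)
  have real: "F w - F' w = 0" if w: "w \<in> range complex_of_real" for w
  proof -
    from w obtain x where "w = complex_of_real x" by blast
    moreover have "F (complex_of_real x) = complex_of_real (g x)"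
      "F' (complex_of_real x) = complex_of_real (g x)"
      using assms(2,3) unfolding strip_extension_def by blast+
    ultimately show ?thesis by simp
  qed
  have lim: "(0::complex) islimpt range complex_of_real"
    unfolding islimpt_approachable
  proof (intro allI impI)
    fix e :: real assume "e > 0"
    thus "\<exists>w\<in>range complex_of_real. w \<noteq> 0 \<and> dist w 0 < e"
      by (intro bexI[of _ "complex_of_real (e / 2)"] rangeI) (auto simp: norm_divide)
  qed
  have sub: "range complex_of_real \<subseteq> strip R" and zero: "0 \<in> strip R"
    using assms(1) by (auto simp: strip_def)
  have "F z - F' z = 0"
    by (rule analytic_continuation[OF holo op conn sub zero lim real assms(4)])
  thus ?thesis by simp
qed

lemma strip_norm_eq:
  assumes "R > 0" "strip_extension R g F"
  shows "strip_norm R g = (SUP z\<in>strip R. norm (F z))"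
proof -
  have ext: "strip_extension R g (SOME F. strip_extension R g F)"
    using someI[of "strip_extension R g", OF assms(2)] .
  have "norm ((SOME F. strip_extension R g F) z) = norm (F z)" if "z \<in> strip R" for z
    using strip_extension_unique[OF assms(1) ext assms(2) that] by simp
  thus ?thesis
    unfolding strip_norm_def by (rule SUP_cong[OF refl])
qed

definition standard_like_map :: "(real \<Rightarrow> real) \<Rightarrow> real \<times> real \<Rightarrow> real \<times> real" where
  "standard_like_map g = (\<lambda>(x, y). (x + y + g x, y + g x))"

definition zero_mean_primitive :: "(real \<Rightarrow> real) \<Rightarrow> real \<Rightarrow> real" where
  "zero_mean_primitive g =
     (THE G. (\<forall>x. (G has_real_derivative g x) (at x)) \<and> integral {0..1} G = 0)"

definition generating_function :: "(real \<Rightarrow> real) \<Rightarrow> real \<Rightarrow> real \<Rightarrow> real" where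
  "generating_function g x x' = (x - x')\<^sup>2 / 2 + zero_mean_primitive g x"

lemma zero_mean_primitive:
  assumes "R > 0" "admissible R g"
  shows "(zero_mean_primitive g has_real_derivative g x) (at x)"
    and "integral {0..1} (zero_mean_primitive g) = 0"
proof -
  obtain F where F: "strip_extension R g F"
    using assms(2) unfolding admissible_def by blast
  hence FR: "F (complex_of_real x) = complex_of_real (g x)" for x
    unfolding strip_extension_def by blast
  have op: "open (strip R)"
    unfolding strip_def by (intro open_Collect_less continuous_intros)
  have "strip R = {z. Im z < R} \<inter> {z. - R < Im z}"
    by (auto simp: strip_def)
  hence "convex (strip R)"
    by (simp add: convex_Int convex_halfspace_Im_lt convex_halfspace_Im_gt)
  then obtain P where P: "\<And>z. z \<in> strip R \<Longrightarrow> (P has_field_derivative F z) (at z within strip R)"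
    using holomorphic_convex_primitive'[of "strip R" F] F op unfolding strip_extension_def by blast
  define G0 where "G0 = (\<lambda>x. Re (P (complex_of_real x)))"
  have G0: "(G0 has_real_derivative g x) (at x)" for x
  proof -
    have "complex_of_real x \<in> strip R"
      using assms(1) by (simp add: strip_def)
    hence "(P has_field_derivative complex_of_real (g x)) (at (complex_of_real x))"
      using P[of "complex_of_real x"] at_within_open[OF _ op] FR by metis
    hence "((\<lambda>x. P (complex_of_real x)) has_vector_derivative complex_of_real (g x)) (at x)"
      by (rule has_vector_derivative_real_field)
    hence "((\<lambda>x. Re (P (complex_of_real x))) has_vector_derivative Re (complex_of_real (g x))) (at x)"
      by (rule bounded_linear.has_vector_derivative[OF bounded_linear_Re])
    thus ?thesis
      by (simp add: G0_def has_real_derivative_iff_has_vector_derivative)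
  qed
  let ?Q = "\<lambda>G. (\<forall>x. (G has_real_derivative g x) (at x)) \<and> integral {0..1} G = 0"
  have int: "G integrable_on {0..1}" if "\<And>x. (G has_real_derivative g x) (at x)" for G :: "real \<Rightarrow> real"
    by (intro integrable_continuous_interval continuous_at_imp_continuous_on ballI DERIV_isCont[OF that])
  have "?Q (\<lambda>x. G0 x - integral {0..1} G0)"
  proof (intro conjI allI)
    show "((\<lambda>x. G0 x - integral {0..1} G0) has_real_derivative g x) (at x)" for x
      using DERIV_diff[OF G0[of x] DERIV_const[of "integral {0..1} G0"]] by simp
    show "integral {0..1} (\<lambda>x. G0 x - integral {0..1} G0) = 0"
      using integral_diff[OF int[OF G0] integrable_const_ivl[of "integral {0..1} G0" 0 1]] by simp
  qed
  moreover have "G = H" if GH: "?Q G" "?Q H" for G H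
  proof -
    have "\<forall>x. ((\<lambda>x. G x - H x) has_real_derivative 0) (at x)"
    proof
      show "((\<lambda>x. G x - H x) has_real_derivative 0) (at x)" for x
        using DERIV_diff[of G "g x" x UNIV H "g x"] GH by simp
    qed
    hence d: "G x - H x = G 0 - H 0" for x
      by (rule DERIV_isconst_all)
    have "integral {0..1} (\<lambda>x. G x - H x) = 0"
      using integral_diff[of G "{0..1}" H] int[of G] int[of H] GH by simp
    moreover have "(\<lambda>x. G x - H x) = (\<lambda>x. G 0 - H 0)"
      using d by (rule ext)
    ultimately have c: "G 0 - H 0 = 0"
      by simp
    show "G = H"
    proof
      show "G x = H x" for x
        using d[of x] c by linarith
    qed
  qed
  ultimately have "\<exists>!G. ?Q G" by blast
  hence "?Q (zero_mean_primitive g)"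
    unfolding zero_mean_primitive_def by (rule theI')
  thus "(zero_mean_primitive g has_real_derivative g x) (at x)"
    and "integral {0..1} (zero_mean_primitive g) = 0" by auto
qed

lemma standard_like_map_generating_function:
  assumes "R > 0" "admissible R g"
  shows "standard_like_map g (x, y) = (x', y') \<longleftrightarrow>
           ((\<lambda>u. generating_function g u x') has_real_derivative - y) (at x) \<and>
           ((\<lambda>v. generating_function g x v) has_real_derivative y') (at x')"
proof -
  have "((\<lambda>u. (u - x')\<^sup>2 / 2) has_real_derivative x - x') (at x)"
    by (auto intro!: derivative_eq_intros)
  hence 1: "((\<lambda>u. generating_function g u x') has_real_derivative x - x' + g x) (at x)"
    unfolding generating_function_def
    by (rule DERIV_add[OF _ zero_mean_primitive(1)[OF assms]])
  have 2: "((\<lambda>v. generating_function g x v) has_real_derivative x' - x) (at x')"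
    unfolding generating_function_def by (auto intro!: derivative_eq_intros)
  have "((\<lambda>u. generating_function g u x') has_real_derivative - y) (at x) \<longleftrightarrow>
          x - x' + g x = - y"
    using 1 DERIV_unique[OF 1] by metis
  moreover have "((\<lambda>v. generating_function g x v) has_real_derivative y') (at x') \<longleftrightarrow>
          x' - x = y'"
    using 2 DERIV_unique[OF 2] by metis
  moreover have "standard_like_map g (x, y) = (x', y') \<longleftrightarrow> x + y + g x = x' \<and> y + g x = y'"
    by (simp add: standard_like_map_def)
  ultimately show ?thesis by linarith
qed

definition action :: "(real \<Rightarrow> real) \<Rightarrow> (int \<Rightarrow> real) \<Rightarrow> int \<Rightarrow> int \<Rightarrow> real" where
  "action g x N1 N2 = (\<Sum>j\<in>{N1..<N2}. generating_function g (x j) (x (j + 1)))"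

definition minimal_configuration :: "(real \<Rightarrow> real) \<Rightarrow> (int \<Rightarrow> real) \<Rightarrow> bool" where
  "minimal_configuration g x \<longleftrightarrow>
     (\<forall>N1 N2. N1 < N2 \<longrightarrow>
        (\<forall>u. u N1 = x N1 \<and> u N2 = x N2 \<longrightarrow> action g x N1 N2 \<le> action g u N1 N2))"

definition has_rotation_number :: "(int \<Rightarrow> real) \<Rightarrow> real \<Rightarrow> bool" where
  "has_rotation_number x \<omega> \<longleftrightarrow>
     ((\<lambda>j. x j / real_of_int j) \<longlongrightarrow> \<omega>) at_top \<and> ((\<lambda>j. x j / real_of_int j) \<longlongrightarrow> \<omega>) at_bot"

text \<open>By Aubry--Mather theory the value below exists and does not depend on the configuration.\<close>

definition mather_beta :: "(real \<Rightarrow> real) \<Rightarrow> real \<Rightarrow> real" where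
  "mather_beta g \<omega> =
     (THE b. \<exists>x. minimal_configuration g x \<and> has_rotation_number x \<omega> \<and>
        ((\<lambda>(N1, N2). action g x N1 N2 / real_of_int (N2 - N1)) \<longlongrightarrow> b) (at_bot \<times>\<^sub>F at_top))"

text \<open>Only real arguments \<open>s > 1\<close> are used, where the Dirichlet series converges.\<close>

definition riemann_zeta :: "real \<Rightarrow> real" where
  "riemann_zeta s = (\<Sum>n. 1 / real (Suc n) powr s)"

definition A_real :: "real \<Rightarrow> real \<Rightarrow> real set" where
  "A_real \<tau> M = {\<omega>. \<forall>n::int. \<forall>m::nat. m > 0 \<longrightarrow>
     \<bar>\<omega> - real_of_int n / real m\<bar> \<ge> 1 / (M * real m powr (2 + \<tau>))}"

definition A_complex :: "real \<Rightarrow> real \<Rightarrow> complex set" where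
  "A_complex \<tau> M = {\<omega>. \<exists>\<omega>'\<in>A_real \<tau> M. \<bar>Im \<omega>\<bar> \<ge> \<bar>\<omega>' - Re \<omega>\<bar>}"

definition E :: "complex \<Rightarrow> complex" where
  "E \<omega> = exp (2 * of_real pi * \<i> * \<omega>)"

text \<open>The Riemann sphere: \<open>Some z\<close> is the finite point \<open>z\<close>, and \<open>None\<close> is infinity.\<close>

type_synonym riemann_sphere = "complex option"

definition K_set :: "real \<Rightarrow> real \<Rightarrow> riemann_sphere set" where
  "K_set \<tau> M = (\<lambda>\<omega>. Some (E \<omega>)) ` A_complex \<tau> M \<union> {Some 0, None}"

definition sphere_inverse :: "complex \<Rightarrow> riemann_sphere" where
  "sphere_inverse \<xi> = (if \<xi> = 0 then None else Some (1 / \<xi>))"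

definition difference_quotient ::
    "(complex \<Rightarrow> complex) \<Rightarrow> (complex \<Rightarrow> complex) \<Rightarrow> complex \<times> complex \<Rightarrow> complex" where
  "difference_quotient \<psi> \<psi>' =
     (\<lambda>(q, q'). if q = q' then \<psi>' q else (\<psi> q' - \<psi> q) / (q' - q))"

text \<open>\<open>\<psi>\<close> and its derivative \<open>\<psi>'\<close> are functions on \<open>C\<close>: their values elsewhere are irrelevant.
  The notion is meant for closed perfect \<open>C\<close>, where the derivative is unique.\<close>

definition has_C1hol_derivative ::
    "complex set \<Rightarrow> (complex \<Rightarrow> complex) \<Rightarrow> (complex \<Rightarrow> complex) \<Rightarrow> bool" where
  "has_C1hol_derivative C \<psi> \<psi>' \<longleftrightarrow>
     continuous_on C \<psi> \<and> bounded (\<psi> ` C) \<and>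
     continuous_on C \<psi>' \<and> bounded (\<psi>' ` C) \<and>
     continuous_on (C \<times> C) (difference_quotient \<psi> \<psi>') \<and>
     bounded (difference_quotient \<psi> \<psi>' ` (C \<times> C))"

definition C1hol :: "complex set \<Rightarrow> (complex \<Rightarrow> complex) set" where
  "C1hol C = {\<psi>. \<exists>\<psi>'. has_C1hol_derivative C \<psi> \<psi>'}"

definition C1hol_sphere :: "riemann_sphere set \<Rightarrow> (riemann_sphere \<Rightarrow> complex) set" where
  "C1hol_sphere K = {\<phi>.
     (\<lambda>z. \<phi> (Some z)) \<in> C1hol {z. Some z \<in> K} \<and>
     (\<lambda>\<xi>. \<phi> (sphere_inverse \<xi>)) \<in> C1hol {\<xi>. sphere_inverse \<xi> \<in> K}}"

text \<open>Since \<open>\<omega>\<^sup>2/2 + \<Phi> \<omega>\<close> is unbounded, its derivative is rendered as \<open>\<omega> + \<Phi>' \<omega>\<close>.\<close>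

definition has_complex_extension :: "real \<Rightarrow> real \<Rightarrow> (real \<Rightarrow> real) \<Rightarrow> bool" where
  "has_complex_extension \<tau> M \<beta> \<longleftrightarrow>
     (\<exists>\<Phi> \<Phi>'. has_C1hol_derivative (A_complex \<tau> M) \<Phi> \<Phi>' \<and>
        (\<forall>\<omega>\<in>A_real \<tau> M. (of_real \<omega>)\<^sup>2 / 2 + \<Phi> (of_real \<omega>) = of_real (\<beta> \<omega>)) \<and>
        (\<forall>\<omega>\<in>A_real \<tau> M. \<exists>d. (\<beta> has_real_derivative d) (at \<omega>) \<and>
           of_real \<omega> + \<Phi>' (of_real \<omega>) = of_real d) \<and>
        (\<forall>\<omega>\<in>A_complex \<tau> M. \<Phi> (- \<omega>) = \<Phi> \<omega>) \<and>
        (\<forall>\<omega>\<in>A_complex \<tau> M. \<Phi> (\<omega> + 1) = \<Phi> \<omega>) \<and>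
        (\<forall>\<omega>\<in>A_complex \<tau> M. cnj (\<Phi> \<omega>) = \<Phi> (cnj \<omega>)) \<and>
        (\<exists>\<phi>\<in>C1hol_sphere (K_set \<tau> M). \<forall>\<omega>\<in>A_complex \<tau> M. \<Phi> \<omega> = \<phi> (Some (E \<omega>))))"

text \<open>The upper bound on \<open>M\<close> is infinite when \<open>g = 0\<close>, whereas \<open>c / 0 = 0\<close> in HOL; hence the
  disjunction.\<close>

definition property_P :: "real \<Rightarrow> real \<Rightarrow> real \<Rightarrow> bool" where
  "property_P \<tau> R1 c \<longleftrightarrow>
     (\<forall>g M. admissible R1 g \<and> strip_norm R1 g < c \<and>
        1 < M / (2 * riemann_zeta (1 + \<tau>)) \<and>
        (strip_norm R1 g = 0 \<or>
         M / (2 * riemann_zeta (1 + \<tau>)) < (c / strip_norm R1 g) powr (1 / 8))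
        \<longrightarrow> has_complex_extension \<tau> M (mather_beta g))"

definition determined_among :: "('a \<Rightarrow> 'b) set \<Rightarrow> 'a set \<Rightarrow> 'a set \<Rightarrow> ('a \<Rightarrow> 'b) \<Rightarrow> bool" where
  "determined_among \<F> \<Omega> A f \<longleftrightarrow>
     (\<forall>f'\<in>\<F>. (\<forall>x\<in>\<Omega>. f' x = f x) \<longrightarrow> (\<forall>x\<in>A. f' x = f x))"

text \<open>The beta functions with which that of \<open>g\<close> is compared. The bound says that the norm of
  \<open>g'\<close> is less than twice that of \<open>g\<close> (both vanish if \<open>g = 0\<close>). This is the largest range of
  norms for which \<open>M = 2 \<zeta>(1 + \<tau>) (c / (2 \<parallel>g\<parallel>))\<^sup>1\<^sup>/\<^sup>8\<close> is allowed in \<open>property_P\<close> for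
  both functions.\<close>

definition comparison_betas :: "real \<Rightarrow> (real \<Rightarrow> real) \<Rightarrow> (real \<Rightarrow> real) set" where
  "comparison_betas R g =
     {mather_beta g' | g'. admissible R g' \<and> (\<exists>\<kappa><2. strip_norm R g' \<le> \<kappa> * strip_norm R g)}"

end

theory Submission
  imports Defs
begin

text \<open>
  Both functions \<open>\<beta>\<close> and \<open>\<beta>'\<close> that are compared extend to the complex set \<open>A_complex \<tau> M\<close>, by
  functions that differ from \<open>\<omega>\<^sup>2/2\<close> by bounded \<open>\<C>\<^sup>1\<close>-holomorphic ones \<open>\<Phi>\<close> and \<open>\<Psi>\<close>. The upper half of
  \<open>A_complex \<tau> M\<close> is the union of the closed cones with opening angle \<open>\<pi>/2\<close> that stand on the points
  of \<open>A_real \<tau> M\<close>, and \<open>f = \<Phi> - \<Psi>\<close> is bounded and continuous there and holomorphic inside the cones.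

  Two facts carry the proof. The first is a count: within a period, the complement of \<open>A_real \<tau> M\<close>
  is covered by \<open>m\<close> intervals of length \<open>2 / (M m\<^bsup>2+\<tau>\<^esup>)\<close> for every denominator \<open>m\<close>, hence has measure
  at most \<open>2 \<zeta>(1+\<tau>) / M = (2 \<parallel>g\<parallel> / c)\<^bsup>1/8\<^esup> < (3 \<parallel>g\<parallel> / c)\<^bsup>1/8\<^esup>\<close> (\<open>emeasure_Diff_A_real_le\<close>). Thus the
  given set meets \<open>A_real \<tau> M\<close> in positive measure, and \<open>f\<close> vanishes on a compact \<open>Z \<subseteq> A_real \<tau> M\<close>
  of positive measure.

  The second is a uniqueness theorem in the manner of Privalov (\<open>upper_cone_uniqueness\<close>): such an
  \<open>f\<close> vanishes on all of \<open>A_real \<tau> M\<close>. Its proof compares \<open>f\<close> with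
  \<open>P(x + iy) = \<integral>\<^sub>Z y / ((t - x)\<^sup>2 + y\<^sup>2) dt\<close>, the imaginary part of the Cauchy transform \<open>C\<close>
  of \<open>Z\<close>. A point \<open>x + iy\<close> that lies in no open cone over \<open>Z\<close> is at horizontal distance at least \<open>y\<close>
  from \<open>Z\<close>, so there \<open>P \<le> \<integral> y / (s\<^sup>2 + y\<^sup>2) ds = \<pi>/2\<close>, with the integral over \<open>\<bar>s\<bar> \<ge> y\<close>. Near an interval
  that \<open>Z\<close> almost fills, on the other hand, \<open>P > \<pi>/2\<close> (\<open>poisson_integral_gt_half\<close>). The function
  \<open>f exp (n (- i C - \<pi>/2))\<close> has modulus \<open>\<bar>f\<bar> exp (n (P - \<pi>/2))\<close>. On the boundary of the union of the
  cones over \<open>Z\<close> this is at most \<open>sup \<bar>f\<bar>\<close> off the real line, and tends to \<open>0\<close> at \<open>Z\<close>. By the maximum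
  principle it is at most \<open>sup \<bar>f\<bar>\<close> inside, for every \<open>n\<close>, whence \<open>f = 0\<close> where \<open>P > \<pi>/2\<close>
  (\<open>bounded_holomorphic_zero_at\<close>). Since any two upright cones intersect, analytic continuation
  makes \<open>f\<close> vanish on all cones over \<open>A_real \<tau> M\<close>, and continuity takes this to their apexes.

  If \<open>\<parallel>g\<parallel> = 0\<close>, the set may be empty, but then all functions compared are zero and their
  \<open>\<beta>\<close>-functions coincide.
\<close>

section \<open>Poisson integral of a compact set\<close>

text \<open>This is \<open>\<pi>\<close> times the Poisson kernel of the upper half-plane, normalised so that it is the
  imaginary part of the Cauchy kernel; its integral over the line is \<open>\<pi>\<close>.\<close>

definition poisson_kernel :: "real \<Rightarrow> real \<Rightarrow> real \<Rightarrow> real" where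
  "poisson_kernel x y t = y / ((t - x)\<^sup>2 + y\<^sup>2)"

definition cauchy_transform :: "real set \<Rightarrow> complex \<Rightarrow> complex" where
  "cauchy_transform Z w = (LBINT t:Z. 1 / (of_real t - w))"

lemma poisson_kernel_bounds:
  assumes "y > 0"
  shows "0 \<le> poisson_kernel x y t" "poisson_kernel x y t \<le> 1 / y"
proof -
  show "0 \<le> poisson_kernel x y t"
    using assms by (simp add: poisson_kernel_def)
  have "y / ((t - x)\<^sup>2 + y\<^sup>2) \<le> y / y\<^sup>2"
    using assms by (intro divide_left_mono) (auto intro!: mult_pos_pos add_nonneg_pos)
  then show "poisson_kernel x y t \<le> 1 / y"
    using assms by (simp add: poisson_kernel_def power2_eq_square)
qed

lemma continuous_on_poisson_kernel:
  assumes "y > 0"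
  shows "continuous_on S (poisson_kernel x y)"
proof -
  have "(t - x)\<^sup>2 + y\<^sup>2 \<noteq> 0" for t
    using assms by (simp add: sum_power2_eq_zero_iff)
  then show ?thesis
    unfolding poisson_kernel_def by (intro continuous_intros) auto
qed

lemma set_integrable_compact_continuous:
  fixes f :: "real \<Rightarrow> 'b::{banach,second_countable_topology}"
  assumes "compact S" "continuous_on S f"
  shows "set_integrable lborel S f"
  using borel_integrable_compact[OF assms] unfolding set_integrable_def by simp

lemma poisson_kernel_integral_Icc:
  assumes "y > 0" "a \<le> b"
  shows "(LBINT t:{a..b}. poisson_kernel x y t) = arctan ((b - x) / y) - arctan ((a - x) / y)"
proof -
  have "((\<lambda>t. arctan ((t - x) / y)) has_real_derivative poisson_kernel x y t) (at t)" for t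
  proof -
    have "1 / y / (1 + ((t - x) / y)\<^sup>2) = poisson_kernel x y t"
      using assms(1) by (simp add: poisson_kernel_def field_simps power2_eq_square)
    moreover have "((\<lambda>t. arctan ((t - x) / y)) has_real_derivative 1 / y / (1 + ((t - x) / y)\<^sup>2)) (at t)"
      using assms(1) by (auto intro!: derivative_eq_intros simp: field_simps)
    ultimately show ?thesis by simp
  qed
  then have "(LBINT t. poisson_kernel x y t * indicator {a..b} t)
      = arctan ((b - x) / y) - arctan ((a - x) / y)"
    using continuous_on_poisson_kernel[OF assms(1), of UNIV]
    by (intro integral_FTC_Icc_real assms(2)) (auto simp: continuous_on_eq_continuous_at)
  then show ?thesis
    by (simp add: set_lebesgue_integral_def mult.commute)
qed

text \<open>With \<open>r = 0\<close> this is the bound \<open>\<pi>\<close> on the upper half-plane; with \<open>r = y\<close> it is the bound \<open>\<pi>/2\<close>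
  at the points outside the open cones over \<open>Z\<close>. The mass left is that of the two half-lines
  \<open>\<bar>t - x\<bar> \<ge> r\<close>.\<close>

lemma poisson_integral_le:
  assumes Z: "compact Z" and "y > 0" "0 \<le> r" and far: "\<And>z. z \<in> Z \<Longrightarrow> r \<le> \<bar>x - z\<bar>"
  shows "(LBINT t:Z. poisson_kernel x y t) \<le> pi - 2 * arctan (r / y)"
proof -
  obtain B0 where B0: "\<And>z. z \<in> Z \<Longrightarrow> \<bar>z\<bar> \<le> B0"
    using compact_imp_bounded[OF Z] by (auto simp: bounded_iff)
  define B where "B = max r (\<bar>B0\<bar> + \<bar>x\<bar>)"
  have B: "r \<le> B" "\<And>z. z \<in> Z \<Longrightarrow> \<bar>x - z\<bar> \<le> B"
    using B0 by (fastforce simp: B_def)+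
  let ?k = "poisson_kernel x y"
  note int = set_integrable_compact_continuous[OF _ continuous_on_poisson_kernel[OF \<open>y > 0\<close>]]
  have "(LBINT t:Z. ?k t)
      \<le> (LBINT t. indicator {x-B..x-r} t *\<^sub>R ?k t + indicator {x+r..x+B} t *\<^sub>R ?k t)"
    unfolding set_lebesgue_integral_def
  proof (rule integral_mono)
    show "integrable lborel (\<lambda>t. indicator Z t *\<^sub>R ?k t)"
      using int[OF Z] by (simp add: set_integrable_def)
    show "integrable lborel (\<lambda>t. indicator {x-B..x-r} t *\<^sub>R ?k t + indicator {x+r..x+B} t *\<^sub>R ?k t)"
      using int[OF compact_Icc] unfolding set_integrable_def by (intro Bochner_Integration.integrable_add)
    fix t
    have "t \<in> {x-B..x-r} \<or> t \<in> {x+r..x+B}" if "t \<in> Z"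
      using far[OF that] B(2)[OF that] by (auto simp: abs_if split: if_splits)
    then show "indicator Z t *\<^sub>R ?k t
        \<le> indicator {x-B..x-r} t *\<^sub>R ?k t + indicator {x+r..x+B} t *\<^sub>R ?k t"
      using poisson_kernel_bounds(1)[OF \<open>y > 0\<close>, of x t] by (auto simp: indicator_def)
  qed
  also have "\<dots> = (LBINT t:{x-B..x-r}. ?k t) + (LBINT t:{x+r..x+B}. ?k t)"
    using int[OF compact_Icc] unfolding set_integrable_def set_lebesgue_integral_def
    by (intro Bochner_Integration.integral_add)
  also have "\<dots> = 2 * arctan (B / y) - 2 * arctan (r / y)"
    using \<open>r \<le> B\<close> by (simp add: poisson_kernel_integral_Icc[OF \<open>y > 0\<close>] arctan_minus)
  also have "\<dots> \<le> pi - 2 * arctan (r / y)"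
    using arctan_ubound[of "B / y"] by simp
  finally show ?thesis .
qed

lemma poisson_integral_le_measure:
  assumes Z: "compact Z" and "y > 0"
  shows "(LBINT t:Z. poisson_kernel x y t) \<le> measure lborel Z / y"
proof -
  note int = set_integrable_compact_continuous[OF Z]
  have "(LBINT t:Z. poisson_kernel x y t) \<le> (LBINT t:Z. 1 / y)"
    using poisson_kernel_bounds(2)[OF \<open>y > 0\<close>]
    by (intro set_integral_mono int continuous_on_poisson_kernel assms continuous_on_const) auto
  also have "\<dots> = measure lborel Z / y"
    using Z emeasure_compact_finite[OF Z] by (subst set_integral_const) (auto simp: borel_compact)
  finally show ?thesis .
qed

text \<open>Compared with the full interval, only the part outside \<open>Z\<close> is lost, on which the kernel is at
  most \<open>1/y\<close>.\<close>

lemma poisson_integral_ge: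
  assumes Z: "compact Z" and "y > 0" "a \<le> b"
  shows "(LBINT t:Z. poisson_kernel x y t)
    \<ge> arctan ((b - x) / y) - arctan ((a - x) / y) - measure lborel ({a..b} - Z) / y"
proof -
  let ?k = "poisson_kernel x y"
  note int = set_integrable_compact_continuous[OF _ continuous_on_poisson_kernel[OF \<open>y > 0\<close>]]
  have Zb: "Z \<in> sets borel"
    using Z by (rule borel_compact)
  have fin: "emeasure lborel ({a..b} - Z) < \<infinity>"
    by (rule emeasure_bounded_finite) (simp add: bounded_diff)
  have intD: "integrable lborel (\<lambda>t. indicator ({a..b} - Z) t *\<^sub>R (1 / y))"
    using fin Zb by (auto intro: integrable_real_indicator)
  have "(LBINT t:{a..b}. ?k t)
      \<le> (LBINT t. indicator Z t *\<^sub>R ?k t + indicator ({a..b} - Z) t *\<^sub>R (1 / y))"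
    unfolding set_lebesgue_integral_def
  proof (rule integral_mono)
    show "integrable lborel (\<lambda>t. indicator {a..b} t *\<^sub>R ?k t)"
      using int[OF compact_Icc] by (simp add: set_integrable_def)
    show "integrable lborel (\<lambda>t. indicator Z t *\<^sub>R ?k t + indicator ({a..b} - Z) t *\<^sub>R (1 / y))"
      using int[OF Z] intD unfolding set_integrable_def by (intro Bochner_Integration.integrable_add)
    fix t
    show "indicator {a..b} t *\<^sub>R ?k t
        \<le> indicator Z t *\<^sub>R ?k t + indicator ({a..b} - Z) t *\<^sub>R (1 / y)"
      using poisson_kernel_bounds[OF \<open>y > 0\<close>, of x t] by (auto simp: indicator_def)
  qed
  also have "\<dots> = (LBINT t:Z. ?k t) + (LBINT t. indicator ({a..b} - Z) t *\<^sub>R (1 / y))"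
    using int[OF Z] intD unfolding set_integrable_def set_lebesgue_integral_def
    by (intro Bochner_Integration.integral_add)
  also have "(LBINT t. indicator ({a..b} - Z) t *\<^sub>R (1 / y)) = measure lborel ({a..b} - Z) / y"
    using fin Zb by (subst integral_scaleR_left) auto
  finally show ?thesis
    by (simp add: poisson_kernel_integral_Icc[OF \<open>y > 0\<close> \<open>a \<le> b\<close>])
qed

section \<open>Holomorphy of the Cauchy transform\<close>

lemma continuous_on_cauchy_kernel:
  assumes "Im w > 0"
  shows "continuous_on S (\<lambda>t. 1 / (complex_of_real t - w))"
proof -
  have "complex_of_real t \<noteq> w" for t
    using assms by auto
  then show ?thesis
    by (intro continuous_intros) auto
qed

lemma Im_cauchy_transform:
  assumes Z: "compact Z" and w: "Im w > 0"
  shows "Im (cauchy_transform Z w) = (LBINT t:Z. poisson_kernel (Re w) (Im w) t)"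
proof -
  have "Im (1 / (complex_of_real t - w)) = poisson_kernel (Re w) (Im w) t" for t
    by (simp add: poisson_kernel_def Im_divide)
  then show ?thesis
    using set_integrable_compact_continuous[OF Z continuous_on_cauchy_kernel[OF w]]
    unfolding cauchy_transform_def set_lebesgue_integral_def set_integrable_def
    by (subst integral_Im[symmetric]) auto
qed

text \<open>The error of the difference quotient of \<open>1 / (t - w)\<close> is
  \<open>(v - w) / ((t - v) (t - w)\<^sup>2)\<close>, which is \<open>O(\<bar>v - w\<bar>)\<close> uniformly in \<open>t\<close> as long as \<open>v\<close> and \<open>w\<close> keep
  away from the real line.\<close>

lemma cauchy_transform_DERIV:
  assumes Z: "compact Z" and w: "Im w > 0"
  shows "(cauchy_transform Z has_field_derivative (LBINT t:Z. 1 / (of_real t - w)\<^sup>2)) (at w)"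
proof -
  let ?D = "LBINT t:Z. 1 / (complex_of_real t - w)\<^sup>2"
  define \<delta> where "\<delta> = Im w / 2"
  have \<delta>: "\<delta> > 0" using w by (simp add: \<delta>_def)
  have bound: "cmod ((cauchy_transform Z v - cauchy_transform Z w) / (v - w) - ?D)
      \<le> measure lborel Z / \<delta> ^ 3 * cmod (v - w)"
    if v: "v \<noteq> w" "dist v w < \<delta>" for v
  proof -
    have Imv: "Im v \<ge> \<delta>" "Im v > 0"
      using abs_Im_le_cmod[of "v - w"] v(2) \<delta> by (auto simp: dist_norm \<delta>_def abs_le_iff field_simps)
    have nz: "of_real t \<noteq> w" "of_real t \<noteq> v" for t
      using w Imv by auto
    note int = set_integrable_compact_continuous[OF Z]
    have c1: "continuous_on Z (\<lambda>t. 1 / (complex_of_real t - w)\<^sup>2)"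
      using nz by (intro continuous_intros) auto
    have c2: "continuous_on Z (\<lambda>t. (v - w) / ((of_real t - v) * (of_real t - w)\<^sup>2))"
      using nz by (intro continuous_intros) auto
    note i = int[OF continuous_on_cauchy_kernel[OF w]] int[OF continuous_on_cauchy_kernel[OF Imv(2)]]
      int[OF c1]
    have eq: "(1 / (of_real t - v) - 1 / (of_real t - w)) / (v - w) - 1 / (of_real t - w)\<^sup>2
        = (v - w) / ((of_real t - v) * (of_real t - w)\<^sup>2)" for t
    proof -
      define A B where "A = complex_of_real t - v" and "B = complex_of_real t - w"
      have AB: "A \<noteq> 0" "B \<noteq> 0" "v - w = B - A" "B \<noteq> A"
        using nz[of t] v(1) by (auto simp: A_def B_def)
      have "(1 / A - 1 / B) / (B - A) = 1 / (A * B)"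
        using AB by (simp add: divide_simps)
      moreover have "1 / (A * B) - 1 / B\<^sup>2 = (B - A) / (A * B\<^sup>2)"
        using AB by (simp add: divide_simps power2_eq_square)
      ultimately show ?thesis
        unfolding A_def[symmetric] B_def[symmetric] AB(3) by simp
    qed
    have "(cauchy_transform Z v - cauchy_transform Z w) / (v - w) - ?D
        = (LBINT t:Z. (1 / (of_real t - v) - 1 / (of_real t - w)) / (v - w) - 1 / (of_real t - w)\<^sup>2)"
      unfolding cauchy_transform_def using i by simp
    also have "\<dots> = (LBINT t:Z. (v - w) / ((of_real t - v) * (of_real t - w)\<^sup>2))"
      unfolding eq ..
    also have "cmod \<dots> \<le> (LBINT t:Z. cmod ((v - w) / ((of_real t - v) * (of_real t - w)\<^sup>2)))"
      by (rule set_integral_norm_bound[OF int[OF c2]])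
    also have "\<dots> \<le> (LBINT t:Z. cmod (v - w) / \<delta> ^ 3)"
    proof (rule set_integral_mono)
      fix t
      have "\<delta> \<le> cmod (of_real t - v)" "\<delta> \<le> cmod (of_real t - w)"
        using abs_Im_le_cmod[of "of_real t - v"] abs_Im_le_cmod[of "of_real t - w"] Imv w
        by (auto simp: \<delta>_def)
      then have "\<delta> * \<delta>\<^sup>2 \<le> cmod (of_real t - v) * (cmod (of_real t - w))\<^sup>2"
        using \<delta> by (intro mult_mono power_mono) auto
      then show "cmod ((v - w) / ((of_real t - v) * (of_real t - w)\<^sup>2)) \<le> cmod (v - w) / \<delta> ^ 3"
        using \<delta> nz[of t]
        by (auto simp: norm_divide norm_mult norm_power power3_eq_cube power2_eq_square mult.assoc
            intro!: divide_left_mono mult_pos_pos)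
    qed (intro int continuous_on_norm c2 continuous_on_const)+
    also have "\<dots> = measure lborel Z / \<delta> ^ 3 * cmod (v - w)"
      using Z emeasure_compact_finite[OF Z] by (subst set_integral_const) (auto simp: borel_compact)
    finally show ?thesis .
  qed
  have "((\<lambda>v. (cauchy_transform Z v - cauchy_transform Z w) / (v - w) - ?D) \<longlongrightarrow> 0) (at w)"
  proof (rule Lim_null_comparison)
    show "\<forall>\<^sub>F v in at w. cmod ((cauchy_transform Z v - cauchy_transform Z w) / (v - w) - ?D)
        \<le> measure lborel Z / \<delta> ^ 3 * cmod (v - w)"
      using \<delta> bound by (auto simp: eventually_at)
    show "((\<lambda>v. measure lborel Z / \<delta> ^ 3 * cmod (v - w)) \<longlongrightarrow> 0) (at w)"
      by (intro tendsto_mult_right_zero tendsto_norm_zero LIM_zero tendsto_ident_at)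
  qed
  then show ?thesis
    by (simp add: has_field_derivative_iff LIM_zero_iff)
qed

lemma cauchy_transform_holomorphic:
  assumes "compact Z"
  shows "cauchy_transform Z holomorphic_on {w. Im w > 0}"
  using cauchy_transform_DERIV[OF assms]
  by (auto simp: holomorphic_on_open open_halfspace_Im_gt)

section \<open>A point where the Poisson integral exceeds one half of its maximum\<close>

text \<open>A weak form of Lebesgue's density theorem. Take an open \<open>U \<supseteq> Z\<close> whose excess over \<open>Z\<close> is small
  and a grid so fine that each of its cells which meet \<open>Z\<close> lies in \<open>U\<close>. If \<open>Z\<close> missed a proportion \<open>e\<close>
  of every such cell, then \<open>U - Z\<close> would have measure at least \<open>e\<close> times that of \<open>Z\<close>.\<close>

lemma compact_density_interval:
  fixes Z :: "real set"
  assumes Z: "compact Z" "measure lborel Z > 0" and "e > 0"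
  obtains c d where "c < d" "measure lborel ({c..d} - Z) < e * (d - c)"
proof -
  have Zb: "Z \<in> sets borel"
    using Z(1) by (rule borel_compact)
  obtain U where U: "open U" "Z \<subseteq> U" "U - Z \<in> lmeasurable"
      "emeasure lebesgue (U - Z) < ennreal (e * measure lborel Z)"
    by (rule sets_lebesgue_outer_open[OF fmeasurableD[OF lmeasurable_compact[OF Z(1)]]
        mult_pos_pos[OF \<open>e > 0\<close> Z(2)]])
  obtain \<delta> where "\<delta> > 0" "(\<Union>z\<in>Z. ball z \<delta>) \<subseteq> U"
    by (rule compact_subset_open_imp_ball_epsilon_subset[OF Z(1) U(1,2)])
  then have \<delta>: "\<delta> > 0" "\<And>z. z \<in> Z \<Longrightarrow> ball z \<delta> \<subseteq> U"
    by auto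
  define J where "J = (\<lambda>i::int. {of_int i * \<delta> ..< (of_int i + 1) * \<delta>})"
  have J_floor: "t \<in> J i \<longleftrightarrow> i = \<lfloor>t / \<delta>\<rfloor>" for t i
    using \<delta>(1) unfolding J_def eq_commute[of i] floor_eq_iff by (simp add: field_simps)
  define I where "I = (\<lambda>t. \<lfloor>t / \<delta>\<rfloor>) ` Z"
  have "bounded ((\<lambda>t. t / \<delta>) ` Z)"
    using compact_imp_bounded[OF Z(1)] bounded_scaling[of Z "1 / \<delta>"] by simp
  then obtain B where B: "\<And>t. t \<in> Z \<Longrightarrow> \<bar>t / \<delta>\<bar> \<le> B"
    by (auto simp: bounded_iff)
  have "\<lfloor>t / \<delta>\<rfloor> \<in> {\<lfloor>-B\<rfloor>..\<lfloor>B\<rfloor>}" if "t \<in> Z" for t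
    using B[OF that] unfolding abs_le_iff atLeastAtMost_iff by (intro conjI floor_mono) linarith+
  then have "I \<subseteq> {\<lfloor>-B\<rfloor>..\<lfloor>B\<rfloor>}"
    by (auto simp: I_def)
  then have finI: "finite I"
    by (rule finite_subset) simp
  have JU: "J i \<subseteq> U" if "i \<in> I" for i
  proof
    fix t assume t: "t \<in> J i"
    from that obtain z where z: "z \<in> Z" "z \<in> J i"
      by (auto simp: I_def J_floor)
    have "dist z t < \<delta>"
      using z(2) t by (auto simp: J_def dist_real_def algebra_simps abs_less_iff)
    then show "t \<in> U"
      using \<delta>(2)[OF z(1)] by auto
  qed
  have disj: "disjoint_family_on J I"
    unfolding disjoint_family_on_def by (auto simp: J_floor)
  have J_meas: "measure lborel (J i) = \<delta>" "J i \<in> sets borel" "bounded (J i)" for i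
    using \<delta>(1) by (auto simp: J_def algebra_simps)
  have fin: "emeasure lborel A \<noteq> \<infinity>" if "bounded A" for A :: "real set"
    using emeasure_bounded_finite[OF that] by auto
  have "\<exists>i\<in>I. measure lborel (J i - Z) < e * \<delta>"
  proof (rule ccontr)
    assume "\<not> ?thesis"
    then have large: "e * \<delta> \<le> measure lborel (J i - Z)" if "i \<in> I" for i
      using that by force
    have "Z \<subseteq> (\<Union>i\<in>I. J i)"
      by (auto simp: I_def J_floor)
    then have "measure lborel Z \<le> measure lborel (\<Union>i\<in>I. J i)"
      using Zb J_meas finI by (intro measure_mono_fmeasurable fmeasurableI emeasure_bounded_finite) auto
    also have "\<dots> = (\<Sum>i\<in>I. measure lborel (J i))"
      using finI disj J_meas fin by (intro measure_finite_Union) auto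
    finally have "e * measure lborel Z \<le> (\<Sum>i\<in>I. e * \<delta>)"
      using \<open>e > 0\<close> by (simp add: J_meas sum_distrib_left mult.left_commute)
    also have "\<dots> \<le> (\<Sum>i\<in>I. measure lborel (J i - Z))"
      by (intro sum_mono large)
    also have "\<dots> = measure lborel (\<Union>i\<in>I. J i - Z)"
      using finI disj J_meas fin Zb
      by (intro measure_finite_Union[symmetric] ballI fin bounded_diff)
        (auto simp: disjoint_family_on_def)
    also have "\<dots> = measure lebesgue (\<Union>i\<in>I. J i - Z)"
      using finI J_meas Zb by (subst measure_completion) auto
    also have "\<dots> \<le> measure lebesgue (U - Z)"
      using JU J_meas Zb finI by (intro measure_mono_fmeasurable U(3)) auto
    also have "\<dots> < e * measure lborel Z"
      using U(3,4) Z(2) \<open>e > 0\<close> by (simp add: emeasure_eq_measure2 ennreal_less_iff)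
    finally show False by simp
  qed
  then obtain i where i: "measure lborel (J i - Z) < e * \<delta>" by blast
  define c where "c = of_int i * \<delta>"
  have Jc: "J i = {c..<c + \<delta>}"
    by (simp add: J_def c_def algebra_simps)
  have "measure lborel ({c..c + \<delta>} - Z) \<le> measure lborel ((J i - Z) \<union> {c + \<delta>})"
    using Zb J_meas
    by (intro measure_mono_fmeasurable fmeasurableI emeasure_bounded_finite bounded_Un[THEN iffD2]
        conjI bounded_diff) (auto simp: Jc)
  also have "\<dots> \<le> measure lborel (J i - Z) + measure lborel {c + \<delta>}"
    using Zb J_meas by (intro measure_Un_le) auto
  finally show ?thesis
    using i \<delta>(1) that[of c "c + \<delta>"] by simp
qed

text \<open>Over the middle of an interval \<open>[c, d]\<close>, at a quarter of its length, the Poisson integral of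
  the interval is \<open>2 arctan 2 > \<pi>/2\<close>, and a set that almost fills the interval keeps the excess.\<close>

lemma poisson_integral_gt_half:
  assumes Z: "compact Z" "measure lborel Z > 0"
  obtains w z where "z \<in> Z" "\<bar>Re w - z\<bar> < Im w" "Im (cauchy_transform Z w) > pi / 2"
proof -
  \<comment> \<open>The loss is below \<open>4 e\<close>, so that \<open>2 arctan 2 - 4 e = arctan 2 + \<pi>/4\<close> still exceeds \<open>\<pi>/2\<close>.\<close>
  define e where "e = (arctan 2 - pi / 4) / 4"
  have e: "e > 0"
    using arctan_monotone[of 1 2] unfolding e_def arctan_one by simp
  obtain c d where cd: "c < d" "measure lborel ({c..d} - Z) < e * (d - c)"
    using compact_density_interval[OF Z e] by blast
  define x y where "x = (c + d) / 2" and "y = (d - c) / 4"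
  have y: "y > 0" using cd by (simp add: y_def)
  have "(d - x) / y = 2" "(c - x) / y = -2"
    using cd(1) by (auto simp: x_def y_def field_simps)
  moreover have "measure lborel ({c..d} - Z) / y < 4 * e"
    using cd y by (simp add: y_def field_simps)
  ultimately have large: "(LBINT t:Z. poisson_kernel x y t) > pi / 2"
    using poisson_integral_ge[OF Z(1) y, of c d x] cd(1) e
    by (simp add: arctan_minus e_def field_simps)
  \<comment> \<open>Such a point lies in some cone over \<open>Z\<close>, since outside the cones the integral is at most \<open>\<pi>/2\<close>.\<close>
  have "\<exists>z\<in>Z. \<bar>x - z\<bar> < y"
  proof (rule ccontr)
    assume "\<not> ?thesis"
    then have "(LBINT t:Z. poisson_kernel x y t) \<le> pi - 2 * arctan (y / y)"
      using y by (intro poisson_integral_le Z(1)) auto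
    then show False
      using large y by (simp add: arctan_one)
  qed
  then obtain z where "z \<in> Z" "\<bar>x - z\<bar> < y" by blast
  then show ?thesis
    using that[of z "Complex x y"] large y Im_cauchy_transform[OF Z(1), of "Complex x y"] by simp
qed

section \<open>A uniqueness theorem for bounded holomorphic functions\<close>

text \<open>The region \<open>infdist (Re w) Z < Im w\<close> is the union of the open cones over \<open>Z\<close>. The maximum
  principle for \<open>f exp (n (- i C - \<pi>/2))\<close>, where \<open>C\<close> is the Cauchy transform, bounds
  \<open>\<bar>f w\<bar> exp (n (Im (C w) - \<pi>/2))\<close> independently of \<open>n\<close>. The region is cut off at a height \<open>H\<close> where
  \<open>Im C \<le> \<pi>/2\<close>, which makes it bounded.\<close>

lemma bounded_holomorphic_zero_at:
  assumes Z: "compact Z" "Z \<noteq> {}"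
    and holo: "f holomorphic_on {w. infdist (Re w) Z < Im w}"
    and cont: "continuous_on {w. infdist (Re w) Z \<le> Im w} f"
    and bound: "\<And>w. infdist (Re w) Z \<le> Im w \<Longrightarrow> cmod (f w) \<le> B"
    and zero: "\<And>z. z \<in> Z \<Longrightarrow> f (of_real z) = 0"
    and w: "infdist (Re w) Z < Im w" "Im (cauchy_transform Z w) > pi / 2"
  shows "f w = 0"
proof -
  let ?C = "cauchy_transform Z"
  define H where "H = max (Im w + 1) (2 * measure lborel Z / pi + 1)"
  define S where "S = {w. infdist (Re w) Z < Im w \<and> Im w < H}"
  define T where "T = {w. infdist (Re w) Z \<le> Im w \<and> Im w \<le> H}"
  have H: "Im w < H" "2 * measure lborel Z / pi < H" "H > 0"
    using w(1) infdist_nonneg[of "Re w" Z] by (auto simp: H_def less_max_iff_disj)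
  have "open S"
    unfolding S_def by (intro open_Collect_conj open_Collect_less continuous_intros)
  have "closed T"
    unfolding T_def Collect_conj_eq by (intro closed_Int closed_Collect_le continuous_intros)
  have closure_S: "closure S \<subseteq> T"
    by (rule closure_minimal[OF _ \<open>closed T\<close>]) (auto simp: S_def T_def)
  have Im_nonneg: "Im v \<ge> 0" if "infdist (Re v) Z \<le> Im v" for v
    using that infdist_nonneg[of "Re v" Z] by linarith
  have on_Z: "f v = 0" if "infdist (Re v) Z \<le> Im v" "Im v = 0" for v
  proof -
    have "infdist (Re v) Z = 0"
      using that infdist_nonneg[of "Re v" Z] by linarith
    then have "Re v \<in> Z"
      using in_closed_iff_infdist_zero[OF compact_imp_closed[OF Z(1)] Z(2)] by simp
    then show ?thesis
      using zero[of "Re v"] that(2) by (simp add: of_real_Re complex_is_Real_iff)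
  qed
  have F_bound: "cmod (f w) * exp (real n * (Im (?C w) - pi / 2)) \<le> B" for n
  proof -
    \<comment> \<open>The Cauchy transform is singular on \<open>Z\<close>, but \<open>f\<close> vanishes there and \<open>Im C \<le> \<pi>\<close>, so that setting
    the product to \<open>0\<close> on the real line extends it continuously.\<close>
    define G where "G = (\<lambda>v. f v * exp (of_nat n * (- \<i> * ?C v - of_real (pi / 2))))"
    define F where "F = (\<lambda>v. if Im v = 0 then 0 else G v)"
    have norm_G: "cmod (G v) = cmod (f v) * exp (real n * (Im (?C v) - pi / 2))" for v
      by (simp add: G_def norm_mult)
    have norm_F: "cmod (F v) \<le> cmod (f v) * exp (real n * (pi / 2))" if "v \<in> T" for v
    proof (cases "Im v = 0")
      case False
      then have "Im v > 0"
        using that Im_nonneg[of v] by (auto simp: T_def)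
      then have "Im (?C v) \<le> pi"
        using poisson_integral_le[OF Z(1), of "Im v" 0 "Re v"] by (simp add: Im_cauchy_transform Z(1))
      then have "exp (real n * (Im (?C v) - pi / 2)) \<le> exp (real n * (pi / 2))"
        unfolding exp_le_cancel_iff by (intro mult_left_mono) auto
      then show ?thesis
        using False by (simp add: F_def norm_G mult_left_mono)
    qed (simp add: F_def)
    have holo_C: "?C holomorphic_on {v. Im v > 0}"
      by (rule cauchy_transform_holomorphic[OF Z(1)])
    have SIm: "S \<subseteq> {v. Im v > 0}"
      using infdist_nonneg[of _ Z] by (force simp: S_def intro: le_less_trans)
    have "G holomorphic_on S"
      unfolding G_def
      by (intro holomorphic_intros holomorphic_on_subset[OF holo] holomorphic_on_subset[OF holo_C SIm])
        (auto simp: S_def)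
    then have "F holomorphic_on S"
      by (rule holomorphic_transform) (use SIm in \<open>auto simp: F_def\<close>)
    then have "F holomorphic_on interior S"
      by (simp add: interior_open \<open>open S\<close>)
    moreover have "continuous_on T F"
      unfolding continuous_on_eq_continuous_within
    proof
      fix v assume v: "v \<in> T"
      show "continuous (at v within T) F"
      proof (cases "Im v = 0")
        case True
        have "continuous_on T f"
          using cont by (rule continuous_on_subset) (auto simp: T_def)
        then have "(f \<longlongrightarrow> f v) (at v within T)"
          using v unfolding continuous_on_def by blast
        moreover have "f v = 0"
          using v True by (intro on_Z) (auto simp: T_def)
        ultimately have "(f \<longlongrightarrow> 0) (at v within T)"
          by simp
        then have "((\<lambda>u. cmod (f u) * exp (real n * (pi / 2))) \<longlongrightarrow> 0) (at v within T)"
          by (intro tendsto_mult_left_zero tendsto_norm_zero)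
        then have "(F \<longlongrightarrow> 0) (at v within T)"
          by (rule Lim_null_comparison[rotated]) (simp only: eventually_at_filter, intro always_eventually allI impI norm_F)
        then show ?thesis
          using True by (simp add: continuous_within F_def)
      next
        case False
        then have vpos: "Im v > 0"
          using v Im_nonneg[of v] by (auto simp: T_def)
        have "continuous_on (T \<inter> {u. Im u > 0}) G"
          unfolding G_def
          by (intro continuous_intros continuous_on_subset[OF cont]
              continuous_on_subset[OF holomorphic_on_imp_continuous_on[OF holo_C]])
            (auto simp: T_def)
        then have "continuous_on (T \<inter> {u. Im u > 0}) F"
          by (rule continuous_on_eq) (auto simp: F_def)
        then have "continuous (at v within T \<inter> {u. Im u > 0}) F"
          using v vpos by (auto simp: continuous_on_eq_continuous_within)
        moreover have "at v within T = at v within (T \<inter> {u. Im u > 0})"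
          using vpos by (intro at_within_nhd[of _ "{u. Im u > 0}"]) (auto simp: open_halfspace_Im_gt)
        ultimately show ?thesis by simp
      qed
    qed
    then have "continuous_on (closure S) F"
      using closure_S continuous_on_subset by blast
    moreover have "bounded S"
    proof -
      obtain b where b: "\<And>z. z \<in> Z \<Longrightarrow> \<bar>z\<bar> \<le> b"
        using compact_imp_bounded[OF Z(1)] by (auto simp: bounded_iff)
      have "cmod v \<le> b + H + H" if v: "v \<in> S" for v
      proof -
        obtain z where z: "z \<in> Z" "infdist (Re v) Z = dist (Re v) z"
          using infdist_attains_inf[OF compact_imp_closed[OF Z(1)] Z(2)] by blast
        have "\<bar>Re v\<bar> \<le> b + H" "\<bar>Im v\<bar> \<le> H"
          using b[OF z(1)] z(2) v SIm by (auto simp: S_def dist_real_def)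
        then show ?thesis
          using cmod_le[of v] by linarith
      qed
      then show ?thesis by (auto simp: bounded_iff)
    qed
    moreover have "cmod (F v) \<le> B" if v: "v \<in> frontier S" for v
    proof (cases "Im v = 0")
      case True
      have "0 \<le> B" using bound[of w] w(1) norm_ge_zero[of "f w"] by linarith
      then show ?thesis using True by (simp add: F_def)
    next
      case False
      have vT: "v \<in> T" and "v \<notin> S"
        using v closure_S \<open>open S\<close> by (auto simp: frontier_def interior_open)
      have pos: "Im v > 0"
        using False vT Im_nonneg[of v] by (auto simp: T_def)
      have "Im (?C v) \<le> pi / 2"
      proof (cases "Im v = H")
        case True
        have "measure lborel Z / H \<le> pi / 2"
          using H by (simp add: field_simps)
        then show ?thesis
          using poisson_integral_le_measure[OF Z(1) pos, of "Re v"]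
          unfolding Im_cauchy_transform[OF Z(1) pos] True by linarith
      next
        case False
        then have "infdist (Re v) Z = Im v"
          using vT \<open>v \<notin> S\<close> by (auto simp: S_def T_def)
        then have "Im v \<le> \<bar>Re v - z\<bar>" if "z \<in> Z" for z
          using infdist_le[OF that, of "Re v"] by (simp add: dist_real_def)
        then show ?thesis
          using poisson_integral_le[OF Z(1) pos, of "Im v" "Re v"] pos
          by (simp add: Im_cauchy_transform Z(1) arctan_one)
      qed
      then have "exp (real n * (Im (?C v) - pi / 2)) \<le> 1"
        by (simp add: mult_nonneg_nonpos)
      then have "cmod (f v) * exp (real n * (Im (?C v) - pi / 2)) \<le> cmod (f v)"
        by (simp add: mult_left_le)
      then show ?thesis
        using bound[of v] vT False by (simp add: F_def norm_G T_def)
    qed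
    moreover have "w \<in> S"
      using w H by (simp add: S_def)
    ultimately have "cmod (F w) \<le> B"
      by (rule maximum_modulus_frontier)
    then show ?thesis
      using \<open>w \<in> S\<close> SIm by (auto simp: F_def norm_G)
  qed
  show "f w = 0"
  proof (rule ccontr)
    assume "f w \<noteq> 0"
    define q where "q = exp (Im (?C w) - pi / 2)"
    have "q > 1"
      using w(2) by (simp add: q_def)
    then obtain n where "B / cmod (f w) < q ^ n"
      using real_arch_pow by blast
    then have "B < cmod (f w) * q ^ n"
      using \<open>f w \<noteq> 0\<close> by (simp add: field_simps)
    moreover have "q ^ n = exp (real n * (Im (?C w) - pi / 2))"
      unfolding q_def by (rule exp_of_nat_mult[symmetric])
    ultimately have "B < cmod (f w) * exp (real n * (Im (?C w) - pi / 2))"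
      by simp
    with F_bound[of n] show False by simp
  qed
qed

definition upper_cone :: "real \<Rightarrow> complex set" where
  "upper_cone a = {w. \<bar>Re w - a\<bar> < Im w}"

definition closed_upper_cone :: "real \<Rightarrow> complex set" where
  "closed_upper_cone a = {w. \<bar>Re w - a\<bar> \<le> Im w}"

lemma open_upper_cone: "open (upper_cone a)"
  unfolding upper_cone_def by (intro open_Collect_less continuous_intros)

lemma closed_upper_cone: "closed (closed_upper_cone a)"
  unfolding closed_upper_cone_def by (intro closed_Collect_le continuous_intros)

lemma connected_upper_cone: "connected (upper_cone a)"
proof -
  have "upper_cone a = {w. inner (Complex 1 (-1)) w < a} \<inter> {w. inner (Complex 1 1) w > a}"
    unfolding upper_cone_def by (auto simp: inner_complex_def abs_less_iff)
  then show ?thesis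
    by (metis convex_connected convex_Int convex_halfspace_lt convex_halfspace_gt)
qed

lemma holomorphic_zero_on_upper_cone:
  assumes "f holomorphic_on upper_cone a" "open W" "w \<in> W" "W \<subseteq> upper_cone a"
    and "\<And>v. v \<in> W \<Longrightarrow> f v = 0" "v \<in> upper_cone a"
  shows "f v = 0"
proof (rule analytic_continuation[OF assms(1) open_upper_cone connected_upper_cone])
  show "w islimpt W"
    using assms(2,3) by (simp add: interior_limit_point interior_open)
qed (use assms in auto)

lemma infdist_less_iff_compact:
  fixes x :: real
  assumes "compact Z" "Z \<noteq> {}"
  shows "infdist x Z < e \<longleftrightarrow> (\<exists>z\<in>Z. dist x z < e)" "infdist x Z \<le> e \<longleftrightarrow> (\<exists>z\<in>Z. dist x z \<le> e)"
proof -
  obtain z where "z \<in> Z" "infdist x Z = dist x z"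
    using infdist_attains_inf[OF compact_imp_closed[OF assms(1)] assms(2)] by blast
  then show "infdist x Z < e \<longleftrightarrow> (\<exists>z\<in>Z. dist x z < e)" "infdist x Z \<le> e \<longleftrightarrow> (\<exists>z\<in>Z. dist x z \<le> e)"
    using infdist_le[of _ Z x] by (metis le_less_trans, metis order_trans)
qed

text \<open>From the small set where \<open>f\<close> is already known to vanish, the zero spreads to one cone over \<open>Z\<close>,
  then to every cone over \<open>A\<close>, because upright cones intersect pairwise, and finally to the apexes.\<close>

theorem upper_cone_uniqueness:
  assumes Z: "compact Z" "measure lborel Z > 0" "Z \<subseteq> A"
    and holo: "f holomorphic_on (\<Union>a\<in>A. upper_cone a)"
    and cont: "continuous_on (\<Union>a\<in>A. closed_upper_cone a) f"
    and bound: "bounded (f ` (\<Union>a\<in>A. closed_upper_cone a))"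
    and zero: "\<And>z. z \<in> Z \<Longrightarrow> f (of_real z) = 0"
    and "a \<in> A"
  shows "f (of_real a) = 0"
proof -
  have "Z \<noteq> {}" using Z(2) by auto
  note infdist_iff = infdist_less_iff_compact[OF Z(1) \<open>Z \<noteq> {}\<close>]
  have cones: "{w. infdist (Re w) Z < Im w} \<subseteq> (\<Union>a\<in>A. upper_cone a)"
    "{w. infdist (Re w) Z \<le> Im w} \<subseteq> (\<Union>a\<in>A. closed_upper_cone a)"
    using Z(3) by (auto simp: infdist_iff upper_cone_def closed_upper_cone_def dist_real_def)
  obtain B where B: "\<And>w. w \<in> (\<Union>a\<in>A. closed_upper_cone a) \<Longrightarrow> cmod (f w) \<le> B"
    using bound by (auto simp: bounded_iff)
  have near_Z: "f w = 0" if "z \<in> Z" "w \<in> upper_cone z" "Im (cauchy_transform Z w) > pi / 2" for w z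
  proof (rule bounded_holomorphic_zero_at[where f = f and B = B, OF Z(1) \<open>Z \<noteq> {}\<close>])
    show "f holomorphic_on {w. infdist (Re w) Z < Im w}"
      using holo cones(1) by (rule holomorphic_on_subset)
    show "continuous_on {w. infdist (Re w) Z \<le> Im w} f"
      using cont cones(2) by (rule continuous_on_subset)
    show "cmod (f w) \<le> B" if "infdist (Re w) Z \<le> Im w" for w
      using that by (intro B subsetD[OF cones(2)]) simp
    show "f (of_real z) = 0" if "z \<in> Z" for z
      using that by (rule zero)
    show "infdist (Re w) Z < Im w" "Im (cauchy_transform Z w) > pi / 2"
      using that by (auto simp: infdist_iff upper_cone_def dist_real_def)
  qed
  obtain w z where wz: "z \<in> Z" "\<bar>Re w - z\<bar> < Im w" "Im (cauchy_transform Z w) > pi / 2"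
    using poisson_integral_gt_half[OF Z(1,2)] by blast
  have holo_cone: "f holomorphic_on upper_cone a" if "a \<in> A" for a
    using holo by (rule holomorphic_on_subset) (use that in auto)
  have zA: "z \<in> A" using wz(1) Z(3) by auto
  have f_cone_z: "f v = 0" if "v \<in> upper_cone z" for v
  proof (rule holomorphic_zero_on_upper_cone[OF holo_cone[OF zA] _ _ _ _ that])
    have "continuous_on (upper_cone z) (cauchy_transform Z)"
      using holomorphic_on_imp_continuous_on[OF cauchy_transform_holomorphic[OF Z(1)]]
      by (rule continuous_on_subset) (auto simp: upper_cone_def)
    then have "open (upper_cone z \<inter> cauchy_transform Z -` {v. Im v > pi / 2})"
      by (rule continuous_open_preimage[OF _ open_upper_cone open_halfspace_Im_gt])
    moreover have "upper_cone z \<inter> cauchy_transform Z -` {v. Im v > pi / 2}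
        = {v \<in> upper_cone z. Im (cauchy_transform Z v) > pi / 2}"
      by auto
    ultimately show "open {v \<in> upper_cone z. Im (cauchy_transform Z v) > pi / 2}"
      by simp
    show "w \<in> {v \<in> upper_cone z. Im (cauchy_transform Z v) > pi / 2}"
      using wz by (simp add: upper_cone_def)
  qed (use near_Z[OF wz(1)] in auto)
  have f_cone: "f v = 0" if "v \<in> upper_cone a" for v
  proof (rule holomorphic_zero_on_upper_cone[OF holo_cone[OF \<open>a \<in> A\<close>] _ _ _ _ that])
    show "open (upper_cone z \<inter> upper_cone a)"
      by (intro open_Int open_upper_cone)
    show "Complex a (\<bar>z - a\<bar> + 1) \<in> upper_cone z \<inter> upper_cone a"
      by (auto simp: upper_cone_def)
  qed (use f_cone_z in auto)
  have "of_real a \<in> closure (upper_cone a)"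
    unfolding closure_approachable
  proof (intro allI impI)
    fix e :: real assume "e > 0"
    have "Complex a (e / 2) - of_real a = \<i> * of_real (e / 2)"
      by (simp add: complex_eq_iff)
    then have "dist (Complex a (e / 2)) (of_real a) = cmod (\<i> * of_real (e / 2))"
      by (simp only: dist_norm)
    then have "dist (Complex a (e / 2)) (of_real a) = e / 2"
      using \<open>e > 0\<close> by (simp add: norm_mult)
    moreover have "Complex a (e / 2) \<in> upper_cone a"
      using \<open>e > 0\<close> by (simp add: upper_cone_def)
    ultimately show "\<exists>v\<in>upper_cone a. dist v (of_real a) < e"
      using \<open>e > 0\<close> by (intro bexI[of _ "Complex a (e / 2)"]) simp_all
  qed
  moreover have "closure (upper_cone a) \<subseteq> closed_upper_cone a"
    by (rule closure_minimal[OF _ closed_upper_cone])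
      (auto simp: upper_cone_def closed_upper_cone_def)
  then have "continuous_on (closure (upper_cone a)) f"
    using \<open>a \<in> A\<close> by (intro continuous_on_subset[OF cont]) auto
  ultimately show ?thesis
    using continuous_constant_on_closure[of "upper_cone a" f 0] f_cone by blast
qed

section \<open>Real functions with extensions to the complex set\<close>

lemma has_C1hol_derivative_imp_holomorphic:
  assumes "has_C1hol_derivative C \<psi> \<psi>'" "open S" "S \<subseteq> C"
  shows "\<psi> holomorphic_on S"
proof (rule holomorphic_onI)
  fix q assume q: "q \<in> S"
  have qC: "q \<in> C" and atq: "at q within C = at q"
    using q assms(2,3) by (auto intro!: at_within_interior interiorI[of S])
  have "continuous_on C (\<lambda>q'. difference_quotient \<psi> \<psi>' (q, q'))"
  proof (rule continuous_on_compose2[where g = "difference_quotient \<psi> \<psi>'"])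
    show "continuous_on (C \<times> C) (difference_quotient \<psi> \<psi>')"
      using assms(1) by (simp add: has_C1hol_derivative_def)
    show "continuous_on C (\<lambda>q'. (q, q'))"
      by (intro continuous_intros)
  qed (use qC in auto)
  then have "((\<lambda>q'. difference_quotient \<psi> \<psi>' (q, q')) \<longlongrightarrow>
      difference_quotient \<psi> \<psi>' (q, q)) (at q within C)"
    using qC unfolding continuous_on_def by blast
  then have "((\<lambda>q'. difference_quotient \<psi> \<psi>' (q, q')) \<longlongrightarrow> \<psi>' q) (at q)"
    unfolding atq by (simp add: difference_quotient_def)
  then have "((\<lambda>q'. (\<psi> q' - \<psi> q) / (q' - q)) \<longlongrightarrow> \<psi>' q) (at q)"
    by (rule Lim_transform_eventually)
      (auto simp: eventually_at_filter difference_quotient_def)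
  then have "(\<psi> has_field_derivative \<psi>' q) (at q)"
    by (simp add: has_field_derivative_iff)
  then show "\<psi> field_differentiable at q within S"
    using field_differentiable_at_within field_differentiable_def by blast
qed

lemma closed_A_real: "closed (A_real \<tau> M)"
proof -
  have "A_real \<tau> M = (\<Inter>n. \<Inter>m\<in>{0<..}.
      {\<omega>. 1 / (M * real m powr (2 + \<tau>)) \<le> \<bar>\<omega> - real_of_int n / real m\<bar>})"
    by (auto simp: A_real_def)
  also have "closed \<dots>"
    by (intro closed_INT ballI closed_Collect_le continuous_intros)
  finally show ?thesis .
qed

text \<open>The coincidence set of \<open>\<beta>1\<close> and \<open>\<beta>2\<close> in \<open>A_real \<tau> M \<inter> [s, s + 1]\<close> is the zero set of a
  continuous function on a compact set. This makes it a compact set to which the uniqueness theorem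
  applies, although \<open>\<Omega>\<close> is only measurable.\<close>

lemma has_complex_extension_eq:
  assumes ext: "has_complex_extension \<tau> M \<beta>1" "has_complex_extension \<tau> M \<beta>2"
    and \<Omega>: "\<Omega> \<subseteq> {s..s + 1}" "\<And>x. x \<in> \<Omega> \<Longrightarrow> \<beta>1 x = \<beta>2 x"
    and pos: "emeasure lebesgue (\<Omega> \<inter> A_real \<tau> M) > 0"
    and \<omega>: "\<omega> \<in> A_real \<tau> M"
  shows "\<beta>1 \<omega> = \<beta>2 \<omega>"
proof -
  let ?A = "A_real \<tau> M"
  obtain \<Phi> \<Phi>' where \<Phi>: "has_C1hol_derivative (A_complex \<tau> M) \<Phi> \<Phi>'"
      "\<And>\<omega>. \<omega> \<in> ?A \<Longrightarrow> (of_real \<omega>)\<^sup>2 / 2 + \<Phi> (of_real \<omega>) = of_real (\<beta>1 \<omega>)"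
    using ext(1) unfolding has_complex_extension_def by blast
  obtain \<Psi> \<Psi>' where \<Psi>: "has_C1hol_derivative (A_complex \<tau> M) \<Psi> \<Psi>'"
      "\<And>\<omega>. \<omega> \<in> ?A \<Longrightarrow> (of_real \<omega>)\<^sup>2 / 2 + \<Psi> (of_real \<omega>) = of_real (\<beta>2 \<omega>)"
    using ext(2) unfolding has_complex_extension_def by blast
  define f where "f = (\<lambda>w. \<Phi> w - \<Psi> w)"
  have f_real: "f (of_real \<omega>) = 0 \<longleftrightarrow> \<beta>1 \<omega> = \<beta>2 \<omega>" if "\<omega> \<in> ?A" for \<omega>
  proof -
    have "f (of_real \<omega>) = of_real (\<beta>1 \<omega>) - of_real (\<beta>2 \<omega>)"
      unfolding f_def using \<Phi>(2)[OF that, symmetric] \<Psi>(2)[OF that, symmetric] by simp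
    then show ?thesis by simp
  qed
  have cones: "(\<Union>a\<in>?A. upper_cone a) \<subseteq> A_complex \<tau> M"
      "(\<Union>a\<in>?A. closed_upper_cone a) \<subseteq> A_complex \<tau> M"
    by (auto simp: upper_cone_def closed_upper_cone_def A_complex_def abs_minus_commute
        intro!: bexI)
  have contA: "continuous_on (A_complex \<tau> M) f"
    using \<Phi>(1) \<Psi>(1) unfolding f_def has_C1hol_derivative_def by (intro continuous_on_diff) auto
  define Z where "Z = {\<omega> \<in> ?A \<inter> {s..s + 1}. \<beta>1 \<omega> = \<beta>2 \<omega>}"
  have "continuous_on (?A \<inter> {s..s + 1}) (\<lambda>\<omega>. f (of_real \<omega>))"
    using contA by (rule continuous_on_compose2) (auto simp: A_complex_def intro!: continuous_intros bexI)
  then have "closed ((?A \<inter> {s..s + 1}) \<inter> (\<lambda>\<omega>. f (of_real \<omega>)) -` {0})"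
    by (intro continuous_closed_preimage closed_Int closed_A_real) auto
  moreover have "Z = (?A \<inter> {s..s + 1}) \<inter> (\<lambda>\<omega>. f (of_real \<omega>)) -` {0}"
    unfolding Z_def using f_real by auto
  ultimately have Z: "compact Z"
    using bounded_subset[OF bounded_closed_interval[of s "s + 1"], of Z]
    by (auto simp: compact_eq_bounded_closed)
  have "emeasure lebesgue (\<Omega> \<inter> ?A) \<le> emeasure lebesgue Z"
    using \<Omega> borel_compact[OF Z] by (intro emeasure_mono) (auto simp: Z_def)
  then have "emeasure lborel Z > 0"
    using pos borel_compact[OF Z] by simp
  then have Zpos: "measure lborel Z > 0"
    using emeasure_compact_finite[OF Z] by (simp add: measure_def enn2real_positive_iff)
  have "f (of_real \<omega>) = 0"
  proof (rule upper_cone_uniqueness[OF Z Zpos _ _ _ _ _ \<omega>])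
    have op: "open (\<Union>a\<in>?A. upper_cone a)"
      by (intro open_UN ballI open_upper_cone)
    show "f holomorphic_on (\<Union>a\<in>?A. upper_cone a)"
      unfolding f_def
      by (intro holomorphic_on_diff has_C1hol_derivative_imp_holomorphic[OF \<Phi>(1) op cones(1)]
          has_C1hol_derivative_imp_holomorphic[OF \<Psi>(1) op cones(1)])
    show "continuous_on (\<Union>a\<in>?A. closed_upper_cone a) f"
      using contA cones(2) by (rule continuous_on_subset)
    have "bounded (f ` A_complex \<tau> M)"
      unfolding f_def using \<Phi>(1) \<Psi>(1)
      by (intro bounded_minus_comp) (auto simp: has_C1hol_derivative_def)
    then show "bounded (f ` (\<Union>a\<in>?A. closed_upper_cone a))"
      using cones(2) by (meson bounded_subset image_mono)
  qed (auto simp: Z_def f_real)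
  then show ?thesis
    using f_real[OF \<omega>] by simp
qed

section \<open>The measure of the Diophantine set\<close>

text \<open>Translating each piece back by its integer turns them into disjoint parts of \<open>I\<close>. Working with all
  translates at once makes the count independent of where the period \<open>[s, s + 1)\<close> begins.\<close>

lemma emeasure_integer_translates_le:
  fixes I :: "real set"
  assumes [measurable]: "I \<in> sets borel"
  shows "emeasure lborel ({s..<s+1} \<inter> (\<Union>q::int. {t. t - of_int q \<in> I})) \<le> emeasure lborel I"
proof -
  define X where "X q = {s..<s+1} \<inter> {t. t - of_int q \<in> I}" for q :: int
  define Y where "Y q = I \<inter> {s - of_int q..<s - of_int q + 1}" for q :: int
  have XY[measurable]: "X q \<in> sets borel" "Y q \<in> sets borel" for q
    unfolding X_def Y_def by measurable
  have shift: "emeasure lborel (X q) = emeasure lborel (Y q)" for q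
  proof -
    have "emeasure lborel (X q) = emeasure (distr lborel borel ((+) (of_int q))) (X q)"
      by (simp add: lborel_distr_plus)
    also have "\<dots> = emeasure lborel ((+) (of_int q) -` X q)"
      by (subst emeasure_distr) auto
    also have "(+) (of_int q) -` X q = Y q"
      by (auto simp: X_def Y_def algebra_simps)
    finally show ?thesis .
  qed
  have Y_floor: "t \<in> Y q \<longleftrightarrow> t \<in> I \<and> q = - \<lfloor>t - s\<rfloor>" for t q
  proof -
    have "q = - \<lfloor>t - s\<rfloor> \<longleftrightarrow> \<lfloor>t - s\<rfloor> = - q" by linarith
    also have "\<dots> \<longleftrightarrow> s - of_int q \<le> t \<and> t < s - of_int q + 1"
      unfolding floor_eq_iff by auto
    finally show ?thesis
      by (auto simp: Y_def)
  qed
  have surj: "(\<Union>n. X (int_decode n)) = (\<Union>q. X q)"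
    using surj_int_decode by (metis image_image)
  have "emeasure lborel ({s..<s+1} \<inter> (\<Union>q::int. {t. t - of_int q \<in> I}))
      = emeasure lborel (\<Union>n. X (int_decode n))"
    unfolding surj by (rule arg_cong[of _ _ "emeasure lborel"]) (auto simp: X_def)
  also have "\<dots> \<le> (\<Sum>n. emeasure lborel (X (int_decode n)))"
    by (intro emeasure_subadditive_countably) auto
  also have "\<dots> = (\<Sum>n. emeasure lborel (Y (int_decode n)))"
    by (simp add: shift)
  also have "\<dots> = emeasure lborel (\<Union>n. Y (int_decode n))"
  proof (rule suminf_emeasure)
    show "disjoint_family (\<lambda>n. Y (int_decode n))"
      unfolding disjoint_family_on_def
      by (metis (no_types, lifting) Y_floor disjoint_iff injD[OF inj_int_decode])
  qed auto
  also have "\<dots> \<le> emeasure lborel I"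
    by (intro emeasure_mono) (auto simp: Y_def)
  finally show ?thesis .
qed

lemma riemann_zeta_sums:
  assumes "s > 1"
  shows "(\<lambda>n. 1 / real (Suc n) powr s) sums riemann_zeta s"
proof -
  have "summable (\<lambda>n. real (Suc n) powr (- s))"
    using assms by (subst summable_Suc_iff) (simp add: summable_real_powr_iff)
  then show ?thesis
    unfolding riemann_zeta_def by (simp add: powr_minus_divide summable_sums)
qed

lemma riemann_zeta_pos:
  assumes "s > 1"
  shows "riemann_zeta s > 0"
  using suminf_pos[OF sums_summable[OF riemann_zeta_sums[OF assms]]]
  by (simp add: riemann_zeta_def)

text \<open>The fractions with denominator \<open>m\<close> are the integer translates of \<open>0/m, \<dots>, (m-1)/m\<close>, so the
  points excluded on their account have measure at most \<open>m \<cdot> 2 / (M m\<^bsup>2+\<tau>\<^esup>)\<close> in a period; the sum over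
  \<open>m\<close> is the zeta value.\<close>

lemma emeasure_Diff_A_real_le:
  assumes "\<tau> > 0" "M > 0"
  shows "emeasure lborel ({s..<s+1} - A_real \<tau> M) \<le> ennreal (2 * riemann_zeta (1 + \<tau>) / M)"
proof -
  \<comment> \<open>The index \<open>m\<close> stands for the denominator \<open>m + 1\<close>.\<close>
  define \<delta> where "\<delta> m = 1 / (M * real (Suc m) powr (2 + \<tau>))" for m
  have \<delta>_pos: "\<delta> m > 0" for m
    using assms by (simp add: \<delta>_def)
  define I where "I m r = {real r / real (Suc m) - \<delta> m <..< real r / real (Suc m) + \<delta> m}" for m r
  define U where "U m r = {s..<s+1} \<inter> (\<Union>q::int. {t. t - of_int q \<in> I m r})" for m r
  have [measurable]: "I m r \<in> sets borel" for m r
    by (simp add: I_def)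
  have U_meas[measurable]: "U m r \<in> sets borel" for m r
    unfolding U_def by measurable
  have "{s..<s+1} - A_real \<tau> M \<subseteq> (\<Union>m. \<Union>r\<in>{..m}. U m r)"
  proof
    fix t assume t: "t \<in> {s..<s+1} - A_real \<tau> M"
    then obtain n m where nm: "m > 0" "\<bar>t - real_of_int n / real m\<bar> < 1 / (M * real m powr (2 + \<tau>))"
      by (auto simp: A_real_def not_le)
    then obtain k where k: "m = Suc k"
      using gr0_implies_Suc by blast
    define r where "r = nat (n mod int m)"
    define q where "q = n div int m"
    have "int r = n mod int m" "n mod int m < int m"
      using nm(1) by (simp_all add: r_def)
    then have r: "r \<le> k" "int r = n mod int m"
      by (simp_all only: k)
    have "n = int r + q * int m"
      by (simp add: r q_def)
    then have "real_of_int n / real m = real r / real m + of_int q"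
      using nm(1) by (simp add: field_simps)
    then have "t - of_int q \<in> I k r"
      using nm(2) by (auto simp: I_def \<delta>_def k abs_less_iff)
    then show "t \<in> (\<Union>m. \<Union>r\<in>{..m}. U m r)"
      using t r(1) by (auto simp: U_def)
  qed
  then have "emeasure lborel ({s..<s+1} - A_real \<tau> M) \<le> emeasure lborel (\<Union>m. \<Union>r\<in>{..m}. U m r)"
    by (intro emeasure_mono) auto
  also have "\<dots> \<le> (\<Sum>m. emeasure lborel (\<Union>r\<in>{..m}. U m r))"
    by (intro emeasure_subadditive_countably) auto
  also have "\<dots> \<le> (\<Sum>m. ennreal (2 / M * (1 / real (Suc m) powr (1 + \<tau>))))"
  proof (intro suminf_le summableI)
    fix m
    have "emeasure lborel (\<Union>r\<in>{..m}. U m r) \<le> (\<Sum>r\<in>{..m}. emeasure lborel (U m r))"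
      by (intro emeasure_subadditive_finite) auto
    also have "\<dots> \<le> (\<Sum>r\<in>{..m}. ennreal (2 * \<delta> m))"
    proof (rule sum_mono)
      fix r
      have "emeasure lborel (U m r) \<le> emeasure lborel (I m r)"
        unfolding U_def by (rule emeasure_integer_translates_le) simp
      also have "\<dots> = ennreal (2 * \<delta> m)"
        using \<delta>_pos[of m] by (simp add: I_def)
      finally show "emeasure lborel (U m r) \<le> ennreal (2 * \<delta> m)" .
    qed
    also have "\<dots> = ennreal (real (Suc m) * (2 * \<delta> m))"
      using \<delta>_pos[of m] by (subst sum_ennreal) auto
    also have "real (Suc m) * (2 * \<delta> m) = 2 / M * (1 / real (Suc m) powr (1 + \<tau>))"
    proof -
      have "real (Suc m) powr (2 + \<tau>) = real (Suc m) powr (1 + (1 + \<tau>))"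
        by simp
      also have "\<dots> = real (Suc m) * real (Suc m) powr (1 + \<tau>)"
        by (subst powr_add) simp
      finally have "\<delta> m = 1 / (M * (real (Suc m) * real (Suc m) powr (1 + \<tau>)))"
        by (simp only: \<delta>_def)
      then show ?thesis
        by (simp del: of_nat_Suc)
    qed
    finally show "emeasure lborel (\<Union>r\<in>{..m}. U m r)
        \<le> ennreal (2 / M * (1 / real (Suc m) powr (1 + \<tau>)))" .
  qed
  also have "\<dots> = ennreal (2 / M * riemann_zeta (1 + \<tau>))"
    using assms sums_mult[OF riemann_zeta_sums, of "1 + \<tau>" "2 / M"]
    by (intro suminf_ennreal_eq) auto
  finally show ?thesis by simp
qed

lemma emeasure_Int_A_real_pos:
  assumes "\<tau> > 0" "M > 0" and \<Omega>: "\<Omega> \<in> sets lebesgue" "\<Omega> \<subseteq> {s..s + 1}"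
    and "2 * riemann_zeta (1 + \<tau>) / M < measure lebesgue \<Omega>"
  shows "emeasure lebesgue (\<Omega> \<inter> A_real \<tau> M) > 0"
proof (rule ccontr)
  let ?r = "2 * riemann_zeta (1 + \<tau>) / M"
  have A: "A_real \<tau> M \<in> sets borel"
    using closed_A_real by (rule borel_closed)
  then have sets: "\<Omega> \<inter> A_real \<tau> M \<in> sets lebesgue" "{s..<s+1} - A_real \<tau> M \<in> sets lebesgue"
    "{s + 1} \<in> sets lebesgue"
    using \<Omega>(1) by auto
  assume "\<not> ?thesis"
  then have null: "emeasure lebesgue (\<Omega> \<inter> A_real \<tau> M) = 0"
    by simp
  have "emeasure lebesgue \<Omega>
      \<le> emeasure lebesgue ((\<Omega> \<inter> A_real \<tau> M) \<union> (({s..<s+1} - A_real \<tau> M) \<union> {s + 1}))"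
    using \<Omega>(2) sets by (intro emeasure_mono sets.Un) force+
  also have "\<dots> \<le> emeasure lebesgue (\<Omega> \<inter> A_real \<tau> M)
      + (emeasure lebesgue ({s..<s+1} - A_real \<tau> M) + emeasure lebesgue {s + 1})"
    using sets by (intro order_trans[OF emeasure_subadditive] add_left_mono emeasure_subadditive sets.Un)
  also have "\<dots> = emeasure lborel ({s..<s+1} - A_real \<tau> M)"
    using A by (simp add: null)
  also have "\<dots> \<le> ennreal ?r"
    by (rule emeasure_Diff_A_real_le[OF assms(1,2)])
  finally have "measure lebesgue \<Omega> \<le> enn2real (ennreal ?r)"
    unfolding measure_def by (intro enn2real_mono) auto
  also have "\<dots> = ?r"
    using riemann_zeta_pos[of "1 + \<tau>"] assms(1,2) by simp
  finally show False
    using assms(5) by simp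
qed

section \<open>Determination of the beta function\<close>

lemma
  assumes "R > 0" "admissible R g"
  shows strip_norm_nonneg: "0 \<le> strip_norm R g"
    and strip_norm_upper: "\<bar>g x\<bar> \<le> strip_norm R g"
proof -
  obtain F where F: "strip_extension R g F" "bounded (F ` strip R)"
    using assms(2) unfolding admissible_def by blast
  have "bdd_above ((\<lambda>z. cmod (F z)) ` strip R)"
    using F(2) by (auto simp: bounded_iff bdd_above_def)
  then have "cmod (F (of_real x)) \<le> strip_norm R g" for x :: real
    unfolding strip_norm_eq[OF assms(1) F(1)]
    by (rule cSUP_upper[rotated]) (use assms(1) in \<open>simp add: strip_def\<close>)
  then have bound: "\<bar>g x\<bar> \<le> strip_norm R g" for x
    using F(1) by (simp add: strip_extension_def)
  from bound show "\<bar>g x\<bar> \<le> strip_norm R g" .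
  show "0 \<le> strip_norm R g"
    using bound[of 0] by linarith
qed

theorem corollary1:
  fixes \<tau> R1 c :: real and g :: "real \<Rightarrow> real"
  assumes "\<tau> > 0" and "R1 > 0" and "c > 0"
    and "property_P \<tau> R1 c"
    and "admissible R1 g"
    and "strip_norm R1 g < c / 3"
  shows "\<exists>M > 2 * riemann_zeta (1 + \<tau>).
           (strip_norm R1 g \<noteq> 0 \<longrightarrow>
              M = 2 * riemann_zeta (1 + \<tau>) * (c / (2 * strip_norm R1 g)) powr (1 / 8)) \<and>
           (\<forall>\<omega>0. \<forall>\<Omega> \<in> sets lebesgue.
              \<Omega> \<subseteq> {\<omega>0..\<omega>0 + 1} \<and>
              measure lebesgue \<Omega> \<ge> (3 * strip_norm R1 g / c) powr (1 / 8) \<longrightarrow>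
              determined_among (comparison_betas R1 g) \<Omega> (A_real \<tau> M) (mather_beta g))"
proof (cases "strip_norm R1 g = 0")
  case True
  \<comment> \<open>Since \<open>g = 0\<close> is compared only with itself, even the empty set determines \<open>\<beta>\<close>, for any \<open>M\<close>.\<close>
  have "g' = g" if "admissible R1 g'" "strip_norm R1 g' \<le> 0" for g'
    using strip_norm_upper[OF assms(2) that(1)] strip_norm_upper[OF assms(2,5)] that(2) True
    by (intro ext) (metis abs_le_zero_iff order_trans)
  then have "\<beta> = mather_beta g" if "\<beta> \<in> comparison_betas R1 g" for \<beta>
    using that True by (auto simp: comparison_betas_def)
  then show ?thesis
    using True by (intro exI[of _ "2 * riemann_zeta (1 + \<tau>) + 1"]) (auto simp: determined_among_def)
next
  case False
  define \<epsilon> where "\<epsilon> = strip_norm R1 g"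
  define Z where "Z = 2 * riemann_zeta (1 + \<tau>)"
  define M where "M = Z * (c / (2 * \<epsilon>)) powr (1 / 8)"
  have \<epsilon>: "\<epsilon> > 0" "\<epsilon> < c / 3"
    using False strip_norm_nonneg[OF assms(2,5)] assms(6) by (auto simp: \<epsilon>_def)
  have Z: "Z > 0"
    using riemann_zeta_pos[of "1 + \<tau>"] assms(1) by (simp add: Z_def)
  have ratio: "M / Z = (c / (2 * \<epsilon>)) powr (1 / 8)"
    using Z by (simp add: M_def)
  have gt1: "M / Z > 1"
    unfolding ratio using \<epsilon> by (intro gr_one_powr) (auto simp: field_simps)
  then have M: "M > Z" "M > 0"
    using Z by (auto simp: field_simps)
  have ext: "has_complex_extension \<tau> M (mather_beta g')"
    if g': "admissible R1 g'" "strip_norm R1 g' < 2 * \<epsilon>" for g'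
  proof -
    have "M / Z < (c / strip_norm R1 g') powr (1 / 8)" if "strip_norm R1 g' \<noteq> 0"
    proof -
      have "strip_norm R1 g' > 0"
        using that strip_norm_nonneg[OF assms(2) g'(1)] by simp
      then have "c / (2 * \<epsilon>) < c / strip_norm R1 g'"
        using g'(2) \<open>c > 0\<close> by (intro divide_strict_left_mono) auto
      then show ?thesis
        unfolding ratio using \<epsilon> \<open>c > 0\<close> by (intro powr_less_mono2) auto
    qed
    then show ?thesis
      using assms(4) g' \<epsilon> gt1 unfolding property_P_def Z_def by fastforce
  qed
  have det: "determined_among (comparison_betas R1 g) \<Omega> (A_real \<tau> M) (mather_beta g)"
    if \<Omega>: "\<Omega> \<in> sets lebesgue" "\<Omega> \<subseteq> {s..s + 1}" "measure lebesgue \<Omega> \<ge> (3 * \<epsilon> / c) powr (1 / 8)" for s \<Omega>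
    unfolding determined_among_def
  proof (intro ballI impI)
    fix \<beta> \<omega> assume "\<beta> \<in> comparison_betas R1 g" and eq: "\<forall>x\<in>\<Omega>. \<beta> x = mather_beta g x"
      and \<omega>: "\<omega> \<in> A_real \<tau> M"
    then obtain g' \<kappa> where g': "\<beta> = mather_beta g'" "admissible R1 g'" "\<kappa> < 2"
        "strip_norm R1 g' \<le> \<kappa> * \<epsilon>"
      by (auto simp: comparison_betas_def \<epsilon>_def)
    have "\<kappa> * \<epsilon> < 2 * \<epsilon>"
      using g'(3) \<epsilon>(1) by simp
    then have ext': "has_complex_extension \<tau> M \<beta>"
      using ext[OF g'(2)] g'(1,4) by simp
    have "Z / M = 1 / (c / (2 * \<epsilon>)) powr (1 / 8)"
      using ratio Z M by (simp add: field_simps)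
    also have "\<dots> = (2 * \<epsilon> / c) powr (1 / 8)"
      using \<epsilon> \<open>c > 0\<close> by (simp add: powr_divide)
    also have "\<dots> < (3 * \<epsilon> / c) powr (1 / 8)"
      using \<epsilon> \<open>c > 0\<close> by (intro powr_less_mono2) (auto simp: divide_strict_right_mono)
    finally have "2 * riemann_zeta (1 + \<tau>) / M < measure lebesgue \<Omega>"
      using \<Omega>(3) by (simp add: Z_def)
    then have "emeasure lebesgue (\<Omega> \<inter> A_real \<tau> M) > 0"
      by (rule emeasure_Int_A_real_pos[OF assms(1) M(2) \<Omega>(1,2)])
    then show "\<beta> \<omega> = mather_beta g \<omega>"
      using has_complex_extension_eq[OF ext' ext[OF assms(5)] \<Omega>(2) _ _ \<omega>] eq \<epsilon>
      by (simp add: \<epsilon>_def)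
  qed
  show ?thesis
    using M(1) det by (intro exI[of _ M]) (auto simp: M_def Z_def \<epsilon>_def)
qed

end
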